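(* Let $\lambda_1,\lambda_2,\lambda_3\in\mathbb{C}$ and $\alpha,\beta,\gamma,\delta_1,\delta_2,\eta_1,\eta_2\in\mathbb{C}$ with $\Re(\alpha)>0$, $\Re(\beta)>0$, $\Re(\gamma)>0$ and $\Re(\delta_j)>0$ for $j=1,2$. Then, as functions of $r>0$, $$\left(r^{\delta_{1}-1}E_{\alpha,\beta,\gamma,\delta_1}^{\eta_1}(\lambda_{1}r^{\alpha},\lambda_{2}r^{\beta},\lambda_{3}r^{\gamma})\right)\ast\left(r^{\delta_{2}-1}E_{\alpha,\beta,\gamma,\delta_2}^{\eta_2}(\lambda_{1}r^{\alpha},\lambda_{2}r^{\beta},\lambda_{3}r^{\gamma})\right)=r^{\delta_{1}+\delta_{2}-1}E_{\alpha,\beta,\gamma,\delta_1+\delta_2}^{\eta_1+\eta_2}(\lambda_{1}r^{\alpha},\lambda_{2}r^{\beta},\lambda_{3}r^{\gamma}).$$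
   Context: The trivariate Mittag-Leffler function is $$E_{\alpha,\beta,\gamma,\delta}^{\eta}(u,v,w)=\sum_{l=0}^{\infty}\sum_{p=0}^{\infty}\sum_{k=0}^{\infty}\frac{(\eta)_{l+p+k}}{\Gamma(l\alpha+p\beta+k\gamma+\delta)}\frac{u^l v^p w^k}{l!\,p!\,k!},$$ for $\alpha,\beta,\gamma,\delta,\eta\in\mathbb{C}$ with $\Re(\alpha),\Re(\beta),\Re(\gamma)>0$ and $u,v,w\in\mathbb{C}$. Here $(\eta)_0=1$, $(\eta)_n=\eta(\eta+1)\cdots(\eta+n-1)$ for $n\ge 1$, and $1/\Gamma$ is the entire reciprocal Gamma function (zero at the poles of $\Gamma$). The convolution is the Laplace convolution $(f\ast g)(r)=\int_0^r f(r-s)g(s)\,ds$ for $r>0$; powers of positive reals are principal. *)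

theory Defs
  imports "HOL-Analysis.Analysis"
begin

text \<open>
  The series is summed iteratedly, \<open>k\<close> innermost. It converges (absolutely) whenever
  \<open>Re \<alpha>\<close>, \<open>Re \<beta>\<close>, \<open>Re \<gamma>\<close> are positive; outside that range it may
  diverge, and the value is then unspecified.
\<close>

definition mittag_leffler3 ::
  "complex \<Rightarrow> complex \<Rightarrow> complex \<Rightarrow> complex \<Rightarrow> complex \<Rightarrow> complex \<Rightarrow> complex \<Rightarrow> complex \<Rightarrow> complex"
where
  "mittag_leffler3 \<alpha> \<beta> \<gamma> \<delta> \<eta> u v w =
     (\<Sum>l. \<Sum>p. \<Sum>k.
        pochhammer \<eta> (l + p + k)
          * rGamma (of_nat l * \<alpha> + of_nat p * \<beta> + of_nat k * \<gamma> + \<delta>)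
          * (u ^ l * v ^ p * w ^ k / (fact l * fact p * fact k)))"

definition laplace_convolution :: "(real \<Rightarrow> complex) \<Rightarrow> (real \<Rightarrow> complex) \<Rightarrow> real \<Rightarrow> complex"
where
  "laplace_convolution f g r = (LBINT s=0..r. f (r - s) * g s)"

end

theory Submission
  imports Defs
begin

text \<open>
  Termwise, the convolution is the complex Beta integral
  \<open>\<integral>\<^sub>0\<^sup>r (r - s) powr (a - 1) * s powr (b - 1) ds = r powr (a + b - 1) * Beta a b\<close>,
  which follows from Fubini applied to \<open>Gamma a * Gamma b\<close>. The terms of total index
  \<open>(m, n, q)\<close> then collect by three applications of Vandermonde's identity
  for Pochhammer symbols.

  Absolute convergence with complex exponents rests on \<open>\<bar>Beta a b\<bar> \<le> Beta (Re a) (Re b)\<close>: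
  it makes \<open>Gamma (Re z) * \<bar>rGamma z\<bar>\<close> submultiplicative in \<open>z\<close>, so that
  passing to real exponents costs only a geometric factor.
\<close>

subsection \<open>The complex Beta integral\<close>

text \<open>Extension by zero turns the convolution over \<open>(0, r)\<close> into an integral over
  the whole line, so that affine substitutions and Fubini need no bookkeeping of domains. The shift
  to \<open>a - 1\<close> matches the integrands of Gamma and Beta.\<close>

definition cut_powr :: "complex \<Rightarrow> real \<Rightarrow> complex" where
  "cut_powr a x = (if x > 0 then of_real x powr (a - 1) else 0)"

lemma norm_cut_powr: "norm (cut_powr a x) = (if x > 0 then x powr (Re a - 1) else 0)"
  by (simp add: cut_powr_def norm_powr_real_powr)

lemma cut_powr_of_real: "cut_powr (of_real a) x = of_real (if x > 0 then x powr (a - 1) else 0)"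
  by (simp add: cut_powr_def powr_Reals_eq)

lemma cut_powr_mult: "u > 0 \<Longrightarrow> cut_powr a (u * x) = of_real u powr (a - 1) * cut_powr a x"
  by (auto simp: cut_powr_def powr_times_real zero_less_mult_iff)

lemma borel_measurable_cut_powr [measurable]: "cut_powr a \<in> borel_measurable borel"
proof -
  have "cut_powr a = (\<lambda>x. indicator {0<..} x *\<^sub>R (of_real x powr (a - 1)))"
    by (auto simp: cut_powr_def fun_eq_iff)
  also have "\<dots> \<in> borel_measurable borel"
    by (auto intro!: borel_measurable_continuous_on_indicator continuous_intros)
  finally show ?thesis .
qed

lemma Gamma_complex_nonzero: "Re z > 0 \<Longrightarrow> Gamma z \<noteq> 0"
  by (auto simp: Gamma_eq_zero_iff elim!: nonpos_Ints_cases)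

lemma has_bochner_integral_Gamma:
  assumes "Re z > 0"
  shows "has_bochner_integral lborel (\<lambda>t. of_real (exp (- t)) * cut_powr z t) (Gamma z)"
proof -
  let ?f = "\<lambda>t. complex_of_real t powr (z - 1) / of_real (exp t)"
  have eq: "(\<lambda>t. of_real (exp (- t)) * cut_powr z t) = (\<lambda>t. indicator {0<..} t *\<^sub>R ?f t)"
    by (auto simp: cut_powr_def fun_eq_iff exp_minus field_simps)
  have int: "set_integrable lborel {0<..} ?f"
    using absolutely_integrable_Gamma_integral'[OF assms]
    unfolding set_integrable_def eq[symmetric]
    \<comment> \<open>Absolute integrability refers to \<open>lebesgue\<close>, the completion of
      \<open>lborel\<close>; for a Borel integrand the two notions agree.\<close>
    by (subst (asm) integrable_completion) auto
  have "(LINT t:{0<..}|lborel. ?f t) = Gamma z"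
    using set_borel_integral_eq_integral(2)[OF int] Gamma_integral_complex'[OF assms]
    by (simp add: integral_unique)
  with int show ?thesis
    unfolding eq has_bochner_integral_iff set_integrable_def set_lebesgue_integral_def by simp
qed

lemma integrable_cut_powr_conv_1:
  assumes "Re a > 0" "Re b > 0"
  shows "integrable lborel (\<lambda>s. cut_powr a (1 - s) * cut_powr b s)"
proof (rule Bochner_Integration.integrable_bound)
  show "integrable lborel (\<lambda>t. indicator {0..1} t *\<^sub>R (t powr (Re b - 1) * (1 - t) powr (Re a - 1)))"
    using integrable_Beta[of "Re b" "Re a"] assms by (simp add: set_integrable_def)
qed (auto simp: norm_mult norm_cut_powr)

text \<open>By homogeneity a single unknown number \<open>I\<close>, the value at
  \<open>r = 1\<close>, determines the convolution at every \<open>r\<close>. For \<open>r\<close>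
  not positive, \<open>r - s\<close> and \<open>s\<close> are never both positive, so both sides
  vanish.\<close>

lemma has_bochner_integral_cut_powr_conv_scale:
  assumes "has_bochner_integral lborel (\<lambda>s. cut_powr a (1 - s) * cut_powr b s) I"
  shows "has_bochner_integral lborel (\<lambda>s. cut_powr a (r - s) * cut_powr b s) (cut_powr (a + b) r * I)"
proof (cases "r > 0")
  case True
  have eq: "cut_powr a (r - r * s) * cut_powr b (r * s) =
    of_real r powr (a + b - 2) * (cut_powr a (1 - s) * cut_powr b s)" for s
    using cut_powr_mult[OF True, of a "1 - s"] cut_powr_mult[OF True, of b s] True
    by (simp add: algebra_simps powr_add[symmetric])
  have "has_bochner_integral lborel (\<lambda>s. cut_powr a (r - (0 + r * s)) * cut_powr b (0 + r * s))
      (of_real r powr (a + b - 2) * I)"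
    using has_bochner_integral_mult_right[OF assms, of "of_real r powr (a + b - 2)"] by (simp add: eq)
  \<comment> \<open>The Jacobian of \<open>s = r * s'\<close> accounts for the missing power of
    \<open>r\<close>.\<close>
  moreover have "of_real r powr (a + b - 2) * I = (cut_powr (a + b) r * I) /\<^sub>R \<bar>r\<bar>"
    using True powr_diff[of "of_real r" "a + b - 1" 1]
    by (simp add: cut_powr_def scaleR_conv_of_real field_simps)
  ultimately show ?thesis using True
    by (subst lborel_has_bochner_integral_real_affine_iff[where c = r and t = 0]) simp_all
next
  case False
  then have "(\<lambda>s. cut_powr a (r - s) * cut_powr b s) = (\<lambda>s. 0)" "cut_powr (a + b) r = 0"
    by (auto simp: cut_powr_def fun_eq_iff)
  then show ?thesis
    by (simp add: has_bochner_integral_zero)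
qed

text \<open>Weight the convolution at \<open>u\<close> by \<open>exp (- u)\<close> and integrate
  over both variables. With \<open>u\<close> first the result is \<open>Gamma a * Gamma b\<close>;
  with \<open>t\<close> first it is \<open>Gamma (a + b) * I\<close>. As
  \<open>Gamma (a + b)\<close> is nonzero, \<open>I\<close> must be \<open>Beta a b\<close>.\<close>

lemma has_bochner_integral_cut_powr_conv:
  assumes a: "Re a > 0" and b: "Re b > 0"
  shows "has_bochner_integral lborel (\<lambda>s. cut_powr a (r - s) * cut_powr b s)
           (cut_powr (a + b) r * Beta a b)"
proof -
  define I where "I = (LBINT s. cut_powr a (1 - s) * cut_powr b s)"
  define F where "F = (\<lambda>t u. of_real (exp (- u)) * (cut_powr a (u - t) * cut_powr b t))"
  have I: "has_bochner_integral lborel (\<lambda>s. cut_powr a (r - s) * cut_powr b s) (cut_powr (a + b) r * I)" for r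
    using integrable_cut_powr_conv_1[OF a b]
    by (intro has_bochner_integral_cut_powr_conv_scale) (simp add: I_def has_bochner_integral_iff)
  have meas: "case_prod F \<in> borel_measurable (lborel \<Otimes>\<^sub>M lborel)"
    unfolding F_def by measurable
  \<comment> \<open>Translating \<open>u\<close> by \<open>t\<close> splits the weight. The claim is
    generic in \<open>a\<close> and \<open>b\<close> because the Fubini hypothesis needs it for the
    real parts as well.\<close>
  have inner: "has_bochner_integral lborel (\<lambda>u. of_real (exp (- u)) * (cut_powr a (u - t) * cut_powr b t))
      (Gamma a * (of_real (exp (- t)) * cut_powr b t))" if "Re a > 0" for a b t
  proof -
    have "has_bochner_integral lborel
        (\<lambda>u. (of_real (exp (- u)) * cut_powr a u) * (of_real (exp (- t)) * cut_powr b t))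
        (Gamma a * (of_real (exp (- t)) * cut_powr b t))"
      using that by (intro has_bochner_integral_mult_left has_bochner_integral_Gamma)
    then show ?thesis
      by (subst lborel_has_bochner_integral_real_affine_iff[where c = 1 and t = t])
         (simp_all add: exp_diff exp_minus field_simps)
  qed
  \<comment> \<open>The norm is the same integrand with \<open>a\<close> and \<open>b\<close>
    replaced by their real parts, so \<open>inner\<close> evaluates its integral too.\<close>
  have norm_F: "norm (F t u) =
      Re (of_real (exp (- u)) * (cut_powr (of_real (Re a)) (u - t) * cut_powr (of_real (Re b)) t))" for t u
    by (simp add: F_def norm_mult norm_cut_powr cut_powr_of_real)
  have inner_norm: "(\<integral>u. norm (F t u) \<partial>lborel) =
      Re (Gamma (of_real (Re a)) * (of_real (exp (- t)) * cut_powr (of_real (Re b)) t))" for t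
    unfolding norm_F using inner[of "of_real (Re a)" t "of_real (Re b)"] a
    by (subst integral_Re) (auto simp: has_bochner_integral_iff)
  have int: "integrable (lborel \<Otimes>\<^sub>M lborel) (case_prod F)"
  proof (rule lborel_pair.Fubini_integrable[OF meas])
    show "integrable lborel (\<lambda>t. \<integral>u. norm (case_prod F (t, u)) \<partial>lborel)"
      using has_bochner_integral_Gamma[of "of_real (Re b)"] b
      by (simp add: inner_norm has_bochner_integral_iff del: times_complex.sel)
    show "AE t in lborel. integrable lborel (\<lambda>u. case_prod F (t, u))"
      using inner[OF a] by (simp add: F_def has_bochner_integral_iff)
  qed
  have "Gamma a * Gamma b = (\<integral>t. (\<integral>u. F t u \<partial>lborel) \<partial>lborel)"
    using inner[OF a] has_bochner_integral_Gamma[OF b] by (simp add: F_def has_bochner_integral_iff)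
  also have "\<dots> = (\<integral>u. (\<integral>t. F t u \<partial>lborel) \<partial>lborel)"
    using lborel_pair.Fubini_integral[OF int] by simp
  also have "\<dots> = (\<integral>u. of_real (exp (- u)) * cut_powr (a + b) u * I \<partial>lborel)"
    using I by (simp add: F_def has_bochner_integral_iff mult.assoc)
  also have "\<dots> = Gamma (a + b) * I"
    using has_bochner_integral_Gamma[of "a + b"] a b by (simp add: has_bochner_integral_iff)
  finally have "I = Beta a b"
    using a b Gamma_complex_nonzero[of "a + b"] by (simp add: Beta_def field_simps)
  with I show ?thesis by simp
qed

lemma has_bochner_integral_norm_cut_powr_conv:
  assumes "Re a > 0" "Re b > 0" "r > 0"
  shows "has_bochner_integral lborel (\<lambda>s. norm (cut_powr a (r - s) * cut_powr b s))
           (r powr (Re a + Re b - 1) * Beta (Re a) (Re b))"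
proof -
  have eq: "norm (cut_powr a (r - s) * cut_powr b s) =
      Re (cut_powr (of_real (Re a)) (r - s) * cut_powr (of_real (Re b)) s)" for s
    by (simp add: norm_mult norm_cut_powr cut_powr_of_real)
  have "cut_powr (of_real (Re a) + of_real (Re b)) r * Beta (of_real (Re a)) (of_real (Re b)) =
      of_real (r powr (Re a + Re b - 1) * Beta (Re a) (Re b))"
    using cut_powr_of_real[of "Re a + Re b" r] assms by (simp add: Beta_complex_of_real)
  with has_bochner_integral_cut_powr_conv[of "of_real (Re a)" "of_real (Re b)" r] assms
  show ?thesis
    unfolding eq has_bochner_integral_iff
    by (auto simp del: times_complex.sel of_real_mult)
qed

text \<open>This is the triangle inequality for the Beta integral, taken at
  \<open>r = 1\<close>.\<close>

lemma norm_Beta_le: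
  assumes "Re a > 0" "Re b > 0"
  shows "norm (Beta a b) \<le> Beta (Re a) (Re b)"
proof -
  have "(\<integral>s. cut_powr a (1 - s) * cut_powr b s \<partial>lborel) = Beta a b"
    using has_bochner_integral_cut_powr_conv[OF assms, of 1]
    by (simp add: has_bochner_integral_iff cut_powr_def[of "a + b"])
  moreover have "(\<integral>s. norm (cut_powr a (1 - s) * cut_powr b s) \<partial>lborel) = Beta (Re a) (Re b)"
    using has_bochner_integral_norm_cut_powr_conv[OF assms, of 1]
    by (simp add: has_bochner_integral_iff)
  ultimately show ?thesis
    using integral_norm_bound[of lborel "\<lambda>s. cut_powr a (1 - s) * cut_powr b s"] by metis
qed

subsection \<open>Growth of the reciprocal Gamma function\<close>

lemma Gamma_real_nonzero: "x > 0 \<Longrightarrow> Gamma x \<noteq> (0::real)"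
  by (metis Gamma_real_pos less_irrefl)

lemma Beta_times_rGamma:
  assumes "Re a > 0" "Re b > 0"
  shows "Beta a b * (rGamma a * rGamma b) = rGamma (a + b)"
  using Gamma_complex_nonzero[OF assms(1)] Gamma_complex_nonzero[OF assms(2)]
  by (simp add: Beta_altdef rGamma_inverse_Gamma field_simps)

lemma rGamma_add_real:
  fixes x y :: real
  assumes "x > 0" "y > 0"
  shows "rGamma (x + y) = Beta x y * rGamma x * rGamma y"
  using Gamma_real_nonzero[of x] Gamma_real_nonzero[of y] assms
  by (simp add: Beta_altdef rGamma_inverse_Gamma field_simps)

lemma rGamma_real_pos: "x > 0 \<Longrightarrow> rGamma x > (0::real)"
  using Gamma_real_pos[of x] by (simp add: rGamma_inverse_Gamma)

lemma Beta_real_pos: "x > 0 \<Longrightarrow> y > 0 \<Longrightarrow> Beta x y > (0::real)"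
  using Gamma_real_pos[of x] Gamma_real_pos[of y] Gamma_real_pos[of "x + y"] by (simp add: Beta_def)

text \<open>This is Gamma(Re z) / |Gamma(z)|, the price of replacing a complex argument of the
  reciprocal Gamma function by its real part.\<close>

definition Gamma_ratio :: "complex \<Rightarrow> real" where
  "Gamma_ratio z = Gamma (Re z) * norm (rGamma z)"

lemma norm_rGamma_eq: "Re z > 0 \<Longrightarrow> norm (rGamma z) = Gamma_ratio z * rGamma (Re z)"
  using Gamma_real_nonzero[of "Re z"] by (simp add: Gamma_ratio_def rGamma_inverse_Gamma field_simps)

lemma Gamma_ratio_nonneg: "Re z > 0 \<Longrightarrow> Gamma_ratio z \<ge> 0"
  using Gamma_real_pos[of "Re z"] by (simp add: Gamma_ratio_def)

text \<open>Rewriting \<open>norm_Beta_le\<close> in terms of Gamma values and rearranging gives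
  exactly this inequality.\<close>

lemma Gamma_ratio_add_le:
  assumes "Re a > 0" "Re b > 0"
  shows "Gamma_ratio (a + b) \<le> Gamma_ratio a * Gamma_ratio b"
proof -
  have pos: "Gamma (Re a + Re b) > 0"
    using assms by (intro Gamma_real_pos) simp
  have "Gamma_ratio (a + b) = Gamma (Re a + Re b) * (norm (Beta a b) * (norm (rGamma a) * norm (rGamma b)))"
    unfolding Gamma_ratio_def Beta_times_rGamma[OF assms, symmetric] by (simp add: norm_mult)
  also have "\<dots> \<le> Gamma (Re a + Re b) * (Beta (Re a) (Re b) * (norm (rGamma a) * norm (rGamma b)))"
    using pos norm_Beta_le[OF assms] by (intro mult_left_mono mult_right_mono) auto
  also have "\<dots> = Gamma_ratio a * Gamma_ratio b"
    using pos by (simp add: Gamma_ratio_def Beta_def)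
  finally show ?thesis .
qed

text \<open>Iterating submultiplicativity costs one factor per summand \<open>a\<close>. The offset
  \<open>d\<close> keeps the argument in the right half-plane even for \<open>n = 0\<close>.\<close>

lemma Gamma_ratio_add_mult_le:
  assumes "Re a > 0" "Re d > 0"
  shows "Gamma_ratio (of_nat n * a + d) \<le> Gamma_ratio a ^ n * Gamma_ratio d"
proof (induction n)
  case (Suc n)
  have "Gamma_ratio (a + (of_nat n * a + d)) \<le> Gamma_ratio a * Gamma_ratio (of_nat n * a + d)"
    using assms by (intro Gamma_ratio_add_le) (auto simp: add_nonneg_pos)
  also have "\<dots> \<le> Gamma_ratio a * (Gamma_ratio a ^ n * Gamma_ratio d)"
    using Suc Gamma_ratio_nonneg[OF assms(1)] by (intro mult_left_mono) auto
  finally show ?case by (simp add: algebra_simps)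
qed simp

lemma Beta_Suc_tendsto_0:
  assumes "a > (0::real)"
  shows "(\<lambda>n. Beta (real n + 1) a) \<longlonglongrightarrow> 0"
proof -
  have "(\<lambda>n. Gamma_series a n * real n powr (- a)) \<longlonglongrightarrow> Gamma a * 0"
    using assms by (intro tendsto_mult Gamma_series_LIMSEQ tendsto_neg_powr filterlim_real_sequentially) auto
  \<comment> \<open>Both sides are n! / (a (a+1) ... (a+n)): the power of \<open>n\<close> in
    Euler's product cancels. Since \<open>Gamma_series a\<close> converges, Beta decays like n to
    the power -a.\<close>
  moreover have "\<forall>\<^sub>F n in sequentially. Gamma_series a n * real n powr (- a) = Beta (real n + 1) a"
    using eventually_gt_at_top[of 0]
  proof eventually_elim
    case (elim n)
    have "a \<notin> \<int>\<^sub>\<le>\<^sub>0" using assms by (auto elim!: nonpos_Ints_cases)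
    with elim show ?case
      by (simp add: Gamma_series_def powr_def exp_minus Beta_def pochhammer_Gamma Gamma_fact[symmetric]
          field_simps)
  qed
  ultimately show ?thesis
    by (simp add: tendsto_cong)
qed

text \<open>Beta decreases in its first argument, so the integer case
  \<open>Beta_Suc_tendsto_0\<close> controls any progression tending to infinity.\<close>

lemma Beta_arith_tendsto_0:
  assumes "a > (0::real)" "d > 0" "b > 0"
  shows "(\<lambda>n. Beta (real n * a + d) b) \<longlonglongrightarrow> 0"
proof (rule order_tendstoI)
  fix e :: real assume "e > 0"
  from order_tendstoD(2)[OF Beta_Suc_tendsto_0[OF assms(3)] this]
  obtain N where N: "Beta (real N + 1) b < e"
    by (auto simp: eventually_sequentially)
  have "filterlim (\<lambda>n. real n * a + d) at_top sequentially"
    using assms by real_asymp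
  then have "\<forall>\<^sub>F n in sequentially. real n * a + d \<ge> real N + 1"
    by (simp add: filterlim_at_top)
  then show "\<forall>\<^sub>F n in sequentially. Beta (real n * a + d) b < e"
    by eventually_elim (rule le_less_trans[OF Beta_real_mono N], use assms in auto)
next
  fix e :: real assume "e < 0"
  then have "e < Beta (real n * a + d) b" for n
    using Beta_real_pos[of "real n * a + d" b] assms by (simp add: add_nonneg_pos)
  then show "\<forall>\<^sub>F n in sequentially. e < Beta (real n * a + d) b" by simp
qed

text \<open>Consecutive terms have a quotient of modulus
  \<open>Beta (real n * a + d) a * (rGamma a * \<bar>U\<bar>)\<close>, which tends to 0. As
  \<open>U\<close> is arbitrary, any geometric factor can be absorbed into it.\<close>

lemma summable_rGamma_arith:
  fixes a d U :: real
  assumes "a > 0" "d > 0"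
  shows "summable (\<lambda>n. rGamma (real n * a + d) * U ^ n)"
proof -
  have "(\<lambda>n. Beta (real n * a + d) a * (rGamma a * \<bar>U\<bar>)) \<longlonglongrightarrow> 0 * (rGamma a * \<bar>U\<bar>)"
    using assms by (intro tendsto_mult Beta_arith_tendsto_0) auto
  then have "\<forall>\<^sub>F n in sequentially. Beta (real n * a + d) a * (rGamma a * \<bar>U\<bar>) < 1/2"
    by (intro order_tendstoD) auto
  then obtain N where N: "\<And>n. n \<ge> N \<Longrightarrow> Beta (real n * a + d) a * (rGamma a * \<bar>U\<bar>) < 1/2"
    by (auto simp: eventually_sequentially)
  show ?thesis
  proof (rule summable_ratio_test)
    fix n assume n: "n \<ge> N"
    have x: "real n * a + d > 0" using assms by (simp add: add_nonneg_pos)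
    have "norm (rGamma (real (Suc n) * a + d) * U ^ Suc n) =
        (Beta (real n * a + d) a * (rGamma a * \<bar>U\<bar>)) * norm (rGamma (real n * a + d) * U ^ n)"
      using rGamma_add_real[OF x assms(1)] rGamma_real_pos[OF assms(1)] Beta_real_pos[OF x assms(1)]
      by (simp add: algebra_simps abs_mult power_abs)
    also have "\<dots> \<le> 1/2 * norm (rGamma (real n * a + d) * U ^ n)"
      using N[OF n] by (intro mult_right_mono) auto
    finally show "norm (rGamma (real (Suc n) * a + d) * U ^ Suc n) \<le> 1/2 * norm (rGamma (real n * a + d) * U ^ n)" .
  qed simp
qed

section \<open>Bounds that separate the three summation indices\<close>

lemma norm_pochhammer_le:
  fixes z :: "'a::real_normed_field"
  shows "norm (pochhammer z n) \<le> (1 + norm z) ^ n * fact n"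
proof (induction n)
  case (Suc n)
  have "norm (z + of_nat n) \<le> norm z + real n"
    using norm_triangle_ineq[of z "of_nat n"] by simp
  also have "\<dots> \<le> (1 + norm z) * (1 + real n)"
    by (simp add: algebra_simps)
  finally have "norm (pochhammer z n) * norm (z + of_nat n) \<le>
      ((1 + norm z) ^ n * fact n) * ((1 + norm z) * (1 + real n))"
    using Suc by (intro mult_mono) auto
  then show ?case
    by (simp only: pochhammer_Suc norm_mult) (simp add: algebra_simps)
qed simp

lemma fact_add_le: "(fact (m + n) :: real) \<le> 2 ^ (m + n) * (fact m * fact n)"
proof -
  have "real ((m + n) choose m) \<le> 2 ^ (m + n)"
    using binomial_le_pow2[of "m + n" m] by (metis of_nat_le_iff of_nat_numeral of_nat_power)
  then show ?thesis
    using binomial_fact[of m "m + n", where 'a = real] by (simp add: field_simps)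
qed

lemma fact_add_add_le: "(fact (l + p + k) :: real) \<le> 4 ^ (l + p + k) * (fact l * fact p * fact k)"
proof -
  have "(fact (l + p + k) :: real) \<le> 2 ^ (l + p + k) * (fact (l + p) * fact k)"
    by (rule fact_add_le)
  also have "\<dots> \<le> 2 ^ (l + p + k) * ((2 ^ (l + p + k) * (fact l * fact p)) * fact k)"
  proof (intro mult_left_mono mult_right_mono)
    \<comment> \<open>The exponent is enlarged to \<open>l + p + k\<close> so that the two powers of
      2 merge into a power of 4.\<close>
    show "(fact (l + p) :: real) \<le> 2 ^ (l + p + k) * (fact l * fact p)"
      using fact_add_le[of l p] by (rule order_trans) (auto intro!: mult_right_mono power_increasing)
  qed auto
  also have "\<dots> = 4 ^ (l + p + k) * (fact l * fact p * fact k)"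
    by (simp add: power_mult_distrib[symmetric] flip: mult.assoc)
  finally show ?thesis .
qed

text \<open>Peeling off one summand at a time leaves two Beta factors. All their arguments are at
  least \<open>e\<close>, and Beta is decreasing in both, so each factor is at most
  \<open>Beta e e\<close>. The bound is a product in the separate variables.\<close>

lemma rGamma_add3_le:
  fixes x y z e :: real
  assumes "e > 0" "x \<ge> e" "y \<ge> e" "z \<ge> e"
  shows "rGamma (x + y + z) \<le> Beta e e ^ 2 * (rGamma x * rGamma y * rGamma z)"
proof -
  have pos: "rGamma x > 0" "rGamma y > 0" "rGamma z > 0" "Beta e e > 0"
    "Beta (x + y) z \<ge> 0" "Beta x y \<ge> 0"
    using assms by (auto intro!: rGamma_real_pos Beta_real_pos less_imp_le[OF Beta_real_pos])
  have "rGamma (x + y + z) = (Beta (x + y) z * Beta x y) * (rGamma x * rGamma y * rGamma z)"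
    using assms by (simp add: rGamma_add_real)
  also have "\<dots> \<le> (Beta e e * Beta e e) * (rGamma x * rGamma y * rGamma z)"
    using assms pos by (intro mult_right_mono mult_mono Beta_real_mono) auto
  finally show ?thesis by (simp add: power2_eq_square)
qed

subsection \<open>Infinite sums and Vandermonde identities\<close>

text \<open>An unordered sum becomes a series over the naturals; \<open>to_nat\<close> need not be
  surjective, hence the padding with zeros.\<close>

lemma has_sum_to_nat_iff:
  fixes h :: "'i::countable \<Rightarrow> 'b::{topological_comm_monoid_add,t2_space}"
  shows "((\<lambda>n. if n \<in> range (to_nat :: 'i \<Rightarrow> nat) then h (from_nat n) else 0) has_sum S) UNIV \<longleftrightarrow> (h has_sum S) UNIV"
proof -
  have "(h has_sum S) UNIV \<longleftrightarrow> ((\<lambda>n. h (from_nat n)) has_sum S) (range (to_nat :: 'i \<Rightarrow> nat))"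
    by (subst has_sum_reindex) (auto simp: o_def)
  also have "\<dots> \<longleftrightarrow> ((\<lambda>n. if n \<in> range (to_nat :: 'i \<Rightarrow> nat) then h (from_nat n) else 0) has_sum S) UNIV"
    by (rule has_sum_cong_neutral) auto
  finally show ?thesis by simp
qed

text \<open>Term-by-term integration for unordered sums: enumerating the index type reduces it to
  \<open>integral_suminf\<close>.\<close>

lemma has_sum_integral_infsum:
  fixes f :: "'i::countable \<Rightarrow> 'a \<Rightarrow> 'b::{banach,second_countable_topology}"
  assumes int: "\<And>i. integrable M (f i)"
    and pt: "\<And>x. x \<in> space M \<Longrightarrow> (\<lambda>i. norm (f i x)) summable_on UNIV"
    and sm: "(\<lambda>i. \<integral>x. norm (f i x) \<partial>M) summable_on UNIV"
  shows "((\<lambda>i. \<integral>x. f i x \<partial>M) has_sum (\<integral>x. (\<Sum>\<^sub>\<infinity>i. f i x) \<partial>M)) UNIV"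
proof -
  define R where "R = range (to_nat :: 'i \<Rightarrow> nat)"
  define g where "g = (\<lambda>n x. if n \<in> R then f (from_nat n) x else 0)"
  have sums: "(\<lambda>n. if n \<in> R then h (from_nat n) else 0) sums infsum h UNIV"
    if "h summable_on UNIV" for h :: "'i \<Rightarrow> 'c::{topological_comm_monoid_add,t2_space}"
    unfolding R_def using that by (intro has_sum_imp_sums) (simp add: has_sum_to_nat_iff)
  have if_norm: "norm (if n \<in> R then u else 0) = (if n \<in> R then norm u else 0)" for n and u :: 'b
    by simp
  have int_g: "(\<integral>x. g n x \<partial>M) = (if n \<in> R then \<integral>x. f (from_nat n) x \<partial>M else 0)"
    "(\<integral>x. norm (g n x) \<partial>M) = (if n \<in> R then \<integral>x. norm (f (from_nat n) x) \<partial>M else 0)" for n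
    by (auto simp: g_def)
  have "(\<lambda>i. norm (\<integral>x. f i x \<partial>M)) summable_on UNIV"
    by (rule summable_on_comparison_test[OF sm]) (auto intro!: integral_norm_bound)
  then have sum_int: "(\<lambda>i. \<integral>x. f i x \<partial>M) summable_on UNIV"
    by (rule abs_summable_summable)
  have "(\<integral>x. (\<Sum>\<^sub>\<infinity>i. f i x) \<partial>M) = (\<integral>x. (\<Sum>n. g n x) \<partial>M)"
    unfolding g_def
    by (intro Bochner_Integration.integral_cong refl sums_unique[OF sums[OF abs_summable_summable[OF pt]]])
  also have "\<dots> = (\<Sum>n. \<integral>x. g n x \<partial>M)"
  proof (rule integral_suminf)
    show "AE x in M. summable (\<lambda>n. norm (g n x))"
      unfolding g_def if_norm using pt by (intro AE_I2 sums_summable[OF sums])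
    show "summable (\<lambda>n. \<integral>x. norm (g n x) \<partial>M)"
      unfolding int_g using sm by (intro sums_summable[OF sums])
    show "integrable M (g n)" for n
      by (cases "n \<in> R") (simp_all add: g_def int)
  qed
  also have "\<dots> = (\<Sum>\<^sub>\<infinity>i. \<integral>x. f i x \<partial>M)"
    unfolding int_g by (intro sums_unique[symmetric] sums sum_int)
  finally show ?thesis
    using sum_int by (simp add: has_sum_iff)
qed

section \<open>Products of sums and iterated series\<close>

lemma abs_summable_on_times:
  fixes f :: "'i \<Rightarrow> 'b::{real_normed_div_algebra,banach}" and g :: "'j \<Rightarrow> 'b"
  assumes f: "(\<lambda>i. norm (f i)) summable_on A" and g: "(\<lambda>j. norm (g j)) summable_on B"
  shows "(\<lambda>x. norm (case x of (i, j) \<Rightarrow> f i * g j)) summable_on A \<times> B"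
proof -
  have "(\<lambda>i. norm (f i) * (\<Sum>\<^sub>\<infinity>j\<in>B. norm (g j))) summable_on A"
    using f by (rule summable_on_cmult_left)
  moreover have "(\<Sum>\<^sub>\<infinity>j\<in>B. norm (g j)) \<ge> 0"
    by (intro infsum_nonneg) auto
  ultimately show ?thesis
    using g by (auto simp: Infinite_Sum.abs_summable_on_Sigma_iff norm_mult infsum_cmult_right
        intro!: summable_on_cmult_right)
qed

lemma infsum_times:
  fixes f :: "'i \<Rightarrow> 'b::{real_normed_div_algebra,banach}" and g :: "'j \<Rightarrow> 'b"
  assumes f: "(\<lambda>i. norm (f i)) summable_on A" and g: "(\<lambda>j. norm (g j)) summable_on B"
  shows "infsum f A * infsum g B = (\<Sum>\<^sub>\<infinity>(i, j)\<in>A \<times> B. f i * g j)"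
proof -
  have "(\<Sum>\<^sub>\<infinity>(i, j)\<in>A \<times> B. f i * g j) = (\<Sum>\<^sub>\<infinity>i\<in>A. \<Sum>\<^sub>\<infinity>j\<in>B. f i * g j)"
    using abs_summable_summable[OF abs_summable_on_times[OF f g]]
    by (simp add: infsum_Sigma'_banach)
  also have "\<dots> = infsum f A * infsum g B"
    using f g by (simp add: infsum_cmult_right infsum_cmult_left abs_summable_summable)
  finally show ?thesis ..
qed

lemma summable_on_Pair:
  fixes f :: "'i \<times> 'j \<Rightarrow> 'b::banach"
  assumes "f summable_on UNIV"
  shows "(\<lambda>y. f (x, y)) summable_on UNIV"
proof -
  have "f summable_on range (Pair x)"
    using assms by (rule summable_on_subset_banach) simp
  then show ?thesis
    using summable_on_reindex[of "Pair x" UNIV f] by (simp add: inj_on_def o_def)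
qed

text \<open>Connects the iterated series defining \<open>mittag_leffler3\<close> with an unordered
  sum, which can be reindexed freely. A \<open>suminf\<close> may be replaced only where it
  converges; unordered summability passes to every slice and to the partial sums over
  slices.\<close>

lemma suminf_suminf_suminf_eq_infsum:
  fixes f :: "nat \<times> nat \<times> nat \<Rightarrow> 'b::banach"
  assumes "f summable_on UNIV"
  shows "(\<Sum>l. \<Sum>p. \<Sum>k. f (l, p, k)) = infsum f UNIV"
proof -
  have suminf: "suminf h = infsum h UNIV" if "h summable_on UNIV" for h :: "nat \<Rightarrow> 'b"
    using that by (intro sums_unique[symmetric] has_sum_imp_sums has_sum_infsum)
  have s1: "(\<lambda>(l, y). f (l, y)) summable_on UNIV \<times> UNIV" using assms by simp
  have s2: "(\<lambda>y. f (l, y)) summable_on UNIV" for l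
    using assms by (rule summable_on_Pair)
  then have s2': "(\<lambda>(p, k). f (l, p, k)) summable_on UNIV \<times> UNIV" for l
    by (simp add: case_prod_unfold)
  have s3: "(\<lambda>k. f (l, p, k)) summable_on UNIV" for l p
    using summable_on_Pair[OF s2] .
  have "(\<Sum>l. \<Sum>p. \<Sum>k. f (l, p, k)) = (\<Sum>l. \<Sum>p. \<Sum>\<^sub>\<infinity>k. f (l, p, k))"
    by (simp add: suminf s3)
  also have "\<dots> = (\<Sum>l. \<Sum>\<^sub>\<infinity>p. \<Sum>\<^sub>\<infinity>k. f (l, p, k))"
    using summable_on_Sigma_banach[OF s2'] by (simp add: suminf)
  also have "\<dots> = (\<Sum>l. \<Sum>\<^sub>\<infinity>y. f (l, y))"
    using infsum_Sigma'_banach[OF s2'] by (simp add: case_prod_unfold)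
  also have "\<dots> = (\<Sum>\<^sub>\<infinity>l. \<Sum>\<^sub>\<infinity>y. f (l, y))"
    using summable_on_Sigma_banach[OF s1] by (intro suminf) simp
  also have "\<dots> = infsum f UNIV"
    using infsum_Sigma'_banach[OF s1] by simp
  finally show ?thesis .
qed

section \<open>Vandermonde identities for Pochhammer symbols\<close>

lemma pochhammer_binomial_sum_shift:
  fixes a b :: "'a::comm_ring_1"
  shows "(\<Sum>k\<le>m. of_nat (m choose k) * pochhammer a (c + k) * pochhammer b (d + (m - k))) =
    pochhammer a c * pochhammer b d * pochhammer (a + b + of_nat (c + d)) m"
proof -
  \<comment> \<open>Splitting off the first \<open>c\<close> and \<open>d\<close> factors leaves the
    ordinary Vandermonde sum with parameters \<open>a + of_nat c\<close> and
    \<open>b + of_nat d\<close>. The last factor of the result depends only on \<open>c + d\<close>,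
    which is what permits iteration.\<close>
  have "(\<Sum>k\<le>m. of_nat (m choose k) * pochhammer a (c + k) * pochhammer b (d + (m - k))) =
      (\<Sum>k\<le>m. pochhammer a c * pochhammer b d *
        (of_nat (m choose k) * pochhammer (a + of_nat c) k * pochhammer (b + of_nat d) (m - k)))"
    by (simp only: pochhammer_product' mult_ac)
  also have "\<dots> = pochhammer a c * pochhammer b d * pochhammer ((a + of_nat c) + (b + of_nat d)) m"
    by (simp only: pochhammer_binomial_sum sum_distrib_left)
  also have "(a + of_nat c) + (b + of_nat d) = a + b + of_nat (c + d)"
    by simp
  finally show ?thesis .
qed

lemma pochhammer_trinomial_sum:
  fixes a b :: "'a::comm_ring_1"
  shows "(\<Sum>l\<le>m. \<Sum>p\<le>n. \<Sum>k\<le>q.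
      of_nat (m choose l) * of_nat (n choose p) * of_nat (q choose k) *
      (pochhammer a (l + p + k) * pochhammer b ((m - l) + (n - p) + (q - k)))) =
    pochhammer (a + b) (m + n + q)"
    (is "(\<Sum>l\<le>m. \<Sum>p\<le>n. \<Sum>k\<le>q. ?t l p k) = _")
proof -
  have inner: "(\<Sum>k\<le>q. ?t l p k) = of_nat (m choose l) * pochhammer (a + b + of_nat (m + n)) q *
      (of_nat (n choose p) * pochhammer a (l + p) * pochhammer b ((m - l) + (n - p)))"
    if "l \<le> m" "p \<le> n" for l p
  proof -
    have "(\<Sum>k\<le>q. ?t l p k) = of_nat (m choose l) * of_nat (n choose p) *
      (\<Sum>k\<le>q. of_nat (q choose k) * pochhammer a ((l + p) + k) * pochhammer b (((m - l) + (n - p)) + (q - k)))"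
      by (simp add: sum_distrib_left mult_ac)
    \<comment> \<open>The factor produced by the sum over \<open>k\<close> is therefore independent
      of \<open>l\<close> and \<open>p\<close> and leaves the outer sums.\<close>
    also have "(l + p) + ((m - l) + (n - p)) = m + n" using that by simp
    ultimately show ?thesis
      unfolding pochhammer_binomial_sum_shift by (simp add: mult_ac)
  qed
  have middle: "(\<Sum>p\<le>n. \<Sum>k\<le>q. ?t l p k) =
      pochhammer (a + b + of_nat m) n * pochhammer (a + b + of_nat (m + n)) q *
      (of_nat (m choose l) * pochhammer a l * pochhammer b (m - l))"
    if "l \<le> m" for l
  proof -
    have "(\<Sum>p\<le>n. \<Sum>k\<le>q. ?t l p k) = (\<Sum>p\<le>n. of_nat (m choose l) * pochhammer (a + b + of_nat (m + n)) q *
      (of_nat (n choose p) * pochhammer a (l + p) * pochhammer b ((m - l) + (n - p))))"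
      by (rule sum.cong[OF refl inner]) (use that in auto)
    also have "\<dots> = of_nat (m choose l) * pochhammer (a + b + of_nat (m + n)) q *
      (\<Sum>p\<le>n. of_nat (n choose p) * pochhammer a (l + p) * pochhammer b ((m - l) + (n - p)))"
      by (simp only: sum_distrib_left)
    finally have "(\<Sum>p\<le>n. \<Sum>k\<le>q. ?t l p k) = of_nat (m choose l) * pochhammer (a + b + of_nat (m + n)) q *
      (\<Sum>p\<le>n. of_nat (n choose p) * pochhammer a (l + p) * pochhammer b ((m - l) + (n - p)))" .
    moreover have "l + (m - l) = m" using that by simp
    ultimately show ?thesis
      unfolding pochhammer_binomial_sum_shift by (simp add: mult_ac)
  qed
  have "(\<Sum>l\<le>m. \<Sum>p\<le>n. \<Sum>k\<le>q. ?t l p k) =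
      (\<Sum>l\<le>m. pochhammer (a + b + of_nat m) n * pochhammer (a + b + of_nat (m + n)) q *
      (of_nat (m choose l) * pochhammer a l * pochhammer b (m - l)))"
    by (rule sum.cong[OF refl middle]) simp
  also have "\<dots> = pochhammer (a + b + of_nat m) n * pochhammer (a + b + of_nat (m + n)) q * pochhammer (a + b) m"
    by (simp only: pochhammer_binomial_sum sum_distrib_left)
  \<comment> \<open>The three factors are consecutive blocks of lengths \<open>m\<close>,
    \<open>n\<close> and \<open>q\<close> of one rising product.\<close>
  also have "\<dots> = pochhammer (a + b) (m + n + q)"
    by (simp add: pochhammer_product' mult_ac add_ac)
  finally show ?thesis .
qed

subsection \<open>The Mittag-Leffler series\<close>

locale mittag_leffler_exponents =
  fixes \<alpha> \<beta> \<gamma> :: complex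
  assumes Re_pos: "Re \<alpha> > 0" "Re \<beta> > 0" "Re \<gamma> > 0"
begin

text \<open>Besides being the argument of \<open>rGamma\<close>, this is one more than the power of
  \<open>t\<close> in the corresponding term after multiplication by
  \<open>of_real t powr (\<delta> - 1)\<close>.\<close>

definition ml_exponent :: "complex \<Rightarrow> nat \<times> nat \<times> nat \<Rightarrow> complex" where
  "ml_exponent \<delta> = (\<lambda>(l, p, k). of_nat l * \<alpha> + of_nat p * \<beta> + of_nat k * \<gamma> + \<delta>)"

definition ml_coeff ::
    "complex \<Rightarrow> complex \<Rightarrow> complex \<Rightarrow> complex \<Rightarrow> complex \<Rightarrow> nat \<times> nat \<times> nat \<Rightarrow> complex" where
  "ml_coeff \<delta> \<eta> x y z = (\<lambda>(l, p, k). pochhammer \<eta> (l + p + k) * rGamma (ml_exponent \<delta> (l, p, k)) *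
     (x ^ l * y ^ p * z ^ k / (fact l * fact p * fact k)))"

lemma Re_ml_exponent_ge: "Re (ml_exponent \<delta> i) \<ge> Re \<delta>"
  using Re_pos by (auto simp: ml_exponent_def split: prod.split)

lemma Re_ml_exponent_pos: "Re \<delta> > 0 \<Longrightarrow> Re (ml_exponent \<delta> i) > 0"
  using Re_ml_exponent_ge[of \<delta> i] by simp

text \<open>\<open>Gamma_ratio\<close> trades the complex exponents for real ones at geometric cost,
  and \<open>rGamma_add3_le\<close> then decouples the indices. \<open>Re \<delta>\<close> is
  divided into thirds so that each of the three real arguments stays bounded away from 0.\<close>

lemma norm_rGamma_ml_exponent_le:
  assumes "Re \<delta> > 0"
  shows "norm (rGamma (ml_exponent \<delta> (l, p, k))) \<le>
    Gamma_ratio \<delta> * Beta (Re \<delta> / 3) (Re \<delta> / 3) ^ 2 *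
    ((rGamma (real l * Re \<alpha> + Re \<delta> / 3) * Gamma_ratio \<alpha> ^ l) *
     ((rGamma (real p * Re \<beta> + Re \<delta> / 3) * Gamma_ratio \<beta> ^ p) *
      (rGamma (real k * Re \<gamma> + Re \<delta> / 3) * Gamma_ratio \<gamma> ^ k)))"
proof -
  note nonneg = Gamma_ratio_nonneg[OF Re_pos(1)] Gamma_ratio_nonneg[OF Re_pos(2)]
    Gamma_ratio_nonneg[OF Re_pos(3)] Gamma_ratio_nonneg[OF assms]
  define e where "e = Re \<delta> / 3"
  let ?w = "ml_exponent \<delta> (l, p, k)"
  have w: "Re ?w > 0" by (rule Re_ml_exponent_pos[OF assms])
  have Re_w: "Re ?w = (real l * Re \<alpha> + e) + (real p * Re \<beta> + e) + (real k * Re \<gamma> + e)"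
    by (simp add: ml_exponent_def e_def)
  have w3: "Re (of_nat k * \<gamma> + \<delta>) > 0" "Re (of_nat p * \<beta> + (of_nat k * \<gamma> + \<delta>)) > 0"
    using Re_pos assms by (auto intro!: add_nonneg_pos)
  have "Gamma_ratio ?w = Gamma_ratio (of_nat l * \<alpha> + (of_nat p * \<beta> + (of_nat k * \<gamma> + \<delta>)))"
    by (simp add: ml_exponent_def add_ac)
  also have "\<dots> \<le> Gamma_ratio \<alpha> ^ l * Gamma_ratio (of_nat p * \<beta> + (of_nat k * \<gamma> + \<delta>))"
    using Re_pos w3 by (intro Gamma_ratio_add_mult_le)
  also have "\<dots> \<le> Gamma_ratio \<alpha> ^ l * (Gamma_ratio \<beta> ^ p * Gamma_ratio (of_nat k * \<gamma> + \<delta>))"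
    using Re_pos w3 nonneg by (intro mult_left_mono Gamma_ratio_add_mult_le) auto
  also have "\<dots> \<le> Gamma_ratio \<alpha> ^ l * (Gamma_ratio \<beta> ^ p * (Gamma_ratio \<gamma> ^ k * Gamma_ratio \<delta>))"
    using Re_pos assms nonneg by (intro mult_left_mono Gamma_ratio_add_mult_le) auto
  finally have ratio: "Gamma_ratio ?w \<le>
      Gamma_ratio \<alpha> ^ l * (Gamma_ratio \<beta> ^ p * (Gamma_ratio \<gamma> ^ k * Gamma_ratio \<delta>))" .
  have real: "rGamma (Re ?w) \<le> Beta e e ^ 2 *
      (rGamma (real l * Re \<alpha> + e) * rGamma (real p * Re \<beta> + e) * rGamma (real k * Re \<gamma> + e))"
    unfolding Re_w using Re_pos assms by (intro rGamma_add3_le) (auto simp: e_def)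
  have "norm (rGamma ?w) = Gamma_ratio ?w * rGamma (Re ?w)"
    by (rule norm_rGamma_eq[OF w])
  also have "\<dots> \<le> (Gamma_ratio \<alpha> ^ l * (Gamma_ratio \<beta> ^ p * (Gamma_ratio \<gamma> ^ k * Gamma_ratio \<delta>))) *
     (Beta e e ^ 2 *
      (rGamma (real l * Re \<alpha> + e) * rGamma (real p * Re \<beta> + e) * rGamma (real k * Re \<gamma> + e)))"
    using ratio real nonneg rGamma_real_pos[OF w] by (intro mult_mono) auto
  finally show ?thesis by (simp add: e_def mult_ac)
qed

text \<open>The factorial growth of the Pochhammer symbol cancels against the denominators up to a
  geometric factor. What remains is dominated by a product of three convergent series in one index
  each.\<close>

lemma ml_coeff_abs_summable:
  assumes "Re \<delta> > 0"
  shows "(\<lambda>i. norm (ml_coeff \<delta> \<eta> x y z i)) summable_on UNIV"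
proof (rule summable_on_comparison_test)
  define e where "e = Re \<delta> / 3"
  \<comment> \<open>The factor \<open>1 + norm \<eta>\<close> comes from
    \<open>norm_pochhammer_le\<close>, the 4 from \<open>fact_add_add_le\<close>.\<close>
  define M where "M = 4 * (1 + norm \<eta>)"
  define K where "K = Gamma_ratio \<delta> * Beta e e ^ 2"
  define s where "s = (\<lambda>(a :: complex) x n. rGamma (real n * Re a + e) * (M * Gamma_ratio a * norm (x :: complex)) ^ n)"
  have "(\<lambda>n. s a x n) summable_on UNIV" "s a x n \<ge> 0" if "Re a > 0" for a x n
  proof -
    show s_nonneg: "s a x n \<ge> 0" for n
      using that assms Gamma_ratio_nonneg[OF that] unfolding s_def M_def e_def
      by (intro mult_nonneg_nonneg zero_le_power less_imp_le[OF rGamma_real_pos])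
         (auto intro: add_nonneg_pos)
    have "summable (s a x)"
      unfolding s_def using that assms by (intro summable_rGamma_arith) (auto simp: e_def)
    then show "(\<lambda>n. s a x n) summable_on UNIV"
      by (simp add: summable_on_UNIV_nonneg_real_iff s_nonneg)
  qed note s = this
  have ss: "(\<lambda>n. norm (s a x n)) summable_on UNIV" if "Re a > 0" for a x
    using s[OF that] by simp
  show "(\<lambda>q. K * (case q of (l, r) \<Rightarrow> s \<alpha> x l * (case r of (p, k) \<Rightarrow> s \<beta> y p * s \<gamma> z k))) summable_on UNIV"
    using abs_summable_summable[OF abs_summable_on_times[OF ss[OF Re_pos(1), of x]
          abs_summable_on_times[OF ss[OF Re_pos(2), of y] ss[OF Re_pos(3), of z]]]]
    by (intro summable_on_cmult_right) simp
  show "norm (ml_coeff \<delta> \<eta> x y z q) \<le>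
      K * (case q of (l, r) \<Rightarrow> s \<alpha> x l * (case r of (p, k) \<Rightarrow> s \<beta> y p * s \<gamma> z k))" for q
  proof (cases q)
    case (fields l p k)
    let ?F = "fact l * fact p * fact k :: real"
    have "norm (pochhammer \<eta> (l + p + k)) \<le> (1 + norm \<eta>) ^ (l + p + k) * fact (l + p + k)"
      by (rule norm_pochhammer_le)
    also have "\<dots> \<le> (1 + norm \<eta>) ^ (l + p + k) * (4 ^ (l + p + k) * ?F)"
      by (intro mult_left_mono fact_add_add_le) auto
    finally have poch: "norm (pochhammer \<eta> (l + p + k)) \<le> M ^ (l + p + k) * ?F"
      by (simp only: M_def power_mult_distrib mult_ac)
    have "norm (ml_coeff \<delta> \<eta> x y z q) = norm (pochhammer \<eta> (l + p + k)) * norm (rGamma (ml_exponent \<delta> (l, p, k))) *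
        (norm x ^ l * norm y ^ p * norm z ^ k / ?F)"
      by (simp add: fields ml_coeff_def norm_mult norm_divide norm_power)
    also have "\<dots> \<le> (M ^ (l + p + k) * ?F) * (K *
        ((rGamma (real l * Re \<alpha> + e) * Gamma_ratio \<alpha> ^ l) *
         ((rGamma (real p * Re \<beta> + e) * Gamma_ratio \<beta> ^ p) *
          (rGamma (real k * Re \<gamma> + e) * Gamma_ratio \<gamma> ^ k)))) *
        (norm x ^ l * norm y ^ p * norm z ^ k / ?F)"
    proof (rule mult_right_mono[OF mult_mono[OF poch]])
      show "0 \<le> M ^ (l + p + k) * ?F"
        by (simp add: M_def)
    qed (use norm_rGamma_ml_exponent_le[OF assms, of l p k] in \<open>simp_all add: K_def e_def\<close>)
    also have "\<dots> = K * (s \<alpha> x l * (s \<beta> y p * s \<gamma> z k))"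
      by (simp add: s_def power_add power_mult_distrib del: of_nat_add)
    finally show ?thesis by (simp add: fields)
  qed
qed auto

lemma mittag_leffler3_eq_infsum:
  assumes "Re \<delta> > 0"
  shows "mittag_leffler3 \<alpha> \<beta> \<gamma> \<delta> \<eta> x y z = infsum (ml_coeff \<delta> \<eta> x y z) UNIV"
proof -
  have "mittag_leffler3 \<alpha> \<beta> \<gamma> \<delta> \<eta> x y z = (\<Sum>l. \<Sum>p. \<Sum>k. ml_coeff \<delta> \<eta> x y z (l, p, k))"
    unfolding mittag_leffler3_def ml_coeff_def ml_exponent_def prod.case by (rule refl)
  also have "\<dots> = infsum (ml_coeff \<delta> \<eta> x y z) UNIV"
    by (rule suminf_suminf_suminf_eq_infsum[OF abs_summable_summable[OF ml_coeff_abs_summable[OF assms]]])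
  finally show ?thesis .
qed

text \<open>All dependence on \<open>t\<close> is gathered into one power, so each term is a
  constant times a \<open>cut_powr\<close> and the Beta integral applies to it.\<close>

lemma ml_coeff_powr:
  assumes "t > 0"
  shows "cut_powr \<delta> t * ml_coeff \<delta> \<eta> (x * of_real t powr \<alpha>) (y * of_real t powr \<beta>) (z * of_real t powr \<gamma>) i =
    ml_coeff \<delta> \<eta> x y z i * cut_powr (ml_exponent \<delta> i) t"
proof (cases i)
  case (fields l p k)
  define L where "L = ln (complex_of_real t)"
  have "exp ((\<delta> - 1) * L) * (exp (\<alpha> * L) ^ l * (exp (\<beta> * L) ^ p * exp (\<gamma> * L) ^ k)) =
      exp ((of_nat l * \<alpha> + of_nat p * \<beta> + of_nat k * \<gamma> + \<delta> - 1) * L)"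
    by (simp add: exp_of_nat_mult[symmetric] exp_add[symmetric] algebra_simps)
  then show ?thesis
    using assms
    by (simp add: fields ml_coeff_def ml_exponent_def cut_powr_def powr_def L_def[symmetric]
        power_mult_distrib)
qed

text \<open>For \<open>t\<close> not positive every term is zero; covering all real \<open>t\<close>
  matters because the termwise integration runs over the whole line.\<close>

lemma ml_term_abs_summable:
  assumes "Re \<delta> > 0"
  shows "(\<lambda>i. norm (ml_coeff \<delta> \<eta> x y z i * cut_powr (ml_exponent \<delta> i) t)) summable_on UNIV"
proof (cases "t > 0")
  case True
  show ?thesis
    unfolding ml_coeff_powr[OF True, symmetric] norm_mult
    by (rule summable_on_cmult_right[OF ml_coeff_abs_summable[OF assms]])
qed (simp add: cut_powr_def)

lemma infsum_ml_term:
  assumes "Re \<delta> > 0" "t > 0"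
  shows "(\<Sum>\<^sub>\<infinity>i. ml_coeff \<delta> \<eta> x y z i * cut_powr (ml_exponent \<delta> i) t) =
    of_real t powr (\<delta> - 1) *
      mittag_leffler3 \<alpha> \<beta> \<gamma> \<delta> \<eta> (x * of_real t powr \<alpha>) (y * of_real t powr \<beta>) (z * of_real t powr \<gamma>)"
    (is "_ = of_real t powr _ * mittag_leffler3 _ _ _ _ _ ?x ?y ?z")
proof -
  have "(\<Sum>\<^sub>\<infinity>i. ml_coeff \<delta> \<eta> x y z i * cut_powr (ml_exponent \<delta> i) t) =
      (\<Sum>\<^sub>\<infinity>i. cut_powr \<delta> t * ml_coeff \<delta> \<eta> ?x ?y ?z i)"
    by (simp only: ml_coeff_powr[OF assms(2)])
  also have "\<dots> = cut_powr \<delta> t * infsum (ml_coeff \<delta> \<eta> ?x ?y ?z) UNIV"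
    by (rule infsum_cmult_right[OF abs_summable_summable[OF ml_coeff_abs_summable[OF assms(1)]]])
  finally show ?thesis
    using assms(2) by (simp add: mittag_leffler3_eq_infsum[OF assms(1)] cut_powr_def[of \<delta>])
qed

section \<open>Collecting the double series by total index\<close>

lemma ml_exponent_add:
  "ml_exponent \<delta>\<^sub>1 (l, p, k) + ml_exponent \<delta>\<^sub>2 (l', p', k') =
     ml_exponent (\<delta>\<^sub>1 + \<delta>\<^sub>2) (l + l', p + p', k + k')"
  by (simp add: ml_exponent_def algebra_simps)

text \<open>Beta merges the two reciprocal Gamma values into one that depends only on the total
  index, and the powers of \<open>x\<close>, \<open>y\<close>, \<open>z\<close> merge likewise. The
  factorials yield binomial coefficients, leaving the sum in
  \<open>pochhammer_trinomial_sum\<close>.\<close>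

lemma ml_coeff_Beta_sum:
  assumes "Re \<delta>\<^sub>1 > 0" "Re \<delta>\<^sub>2 > 0"
  shows "(\<Sum>(l, p, k)\<in>{..m} \<times> {..n} \<times> {..q}.
      ml_coeff \<delta>\<^sub>1 \<eta>\<^sub>1 x y z (l, p, k) * ml_coeff \<delta>\<^sub>2 \<eta>\<^sub>2 x y z (m - l, n - p, q - k) *
      Beta (ml_exponent \<delta>\<^sub>1 (l, p, k)) (ml_exponent \<delta>\<^sub>2 (m - l, n - p, q - k))) =
    ml_coeff (\<delta>\<^sub>1 + \<delta>\<^sub>2) (\<eta>\<^sub>1 + \<eta>\<^sub>2) x y z (m, n, q)"
proof -
  \<comment> \<open>\<open>G\<close> is the target coefficient without its Pochhammer symbol: the
    factor common to all summands.\<close>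
  define G where "G = rGamma (ml_exponent (\<delta>\<^sub>1 + \<delta>\<^sub>2) (m, n, q)) *
    (x ^ m * y ^ n * z ^ q / (fact m * fact n * fact q))"
  have "ml_coeff \<delta>\<^sub>1 \<eta>\<^sub>1 x y z (l, p, k) * ml_coeff \<delta>\<^sub>2 \<eta>\<^sub>2 x y z (m - l, n - p, q - k) *
      Beta (ml_exponent \<delta>\<^sub>1 (l, p, k)) (ml_exponent \<delta>\<^sub>2 (m - l, n - p, q - k)) =
      G * (of_nat (m choose l) * of_nat (n choose p) * of_nat (q choose k) *
      (pochhammer \<eta>\<^sub>1 (l + p + k) * pochhammer \<eta>\<^sub>2 ((m - l) + (n - p) + (q - k))))"
    (is "?A l p k = G * ?B l p k") if "l \<le> m" "p \<le> n" "k \<le> q" for l p k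
  proof -
    let ?a = "ml_exponent \<delta>\<^sub>1 (l, p, k)" and ?b = "ml_exponent \<delta>\<^sub>2 (m - l, n - p, q - k)"
    have "rGamma (ml_exponent (\<delta>\<^sub>1 + \<delta>\<^sub>2) (m, n, q)) = Beta ?a ?b * (rGamma ?a * rGamma ?b)"
      using that Beta_times_rGamma[OF Re_ml_exponent_pos[OF assms(1)] Re_ml_exponent_pos[OF assms(2)]]
      by (simp add: ml_exponent_add)
    moreover have "x ^ m = x ^ l * x ^ (m - l)" "y ^ n = y ^ p * y ^ (n - p)" "z ^ q = z ^ k * z ^ (q - k)"
      using that by (simp_all flip: power_add)
    ultimately show ?thesis
      using that unfolding G_def ml_coeff_def
      by (simp add: binomial_fact mult_ac add_ac)
  qed
  then have "(\<Sum>(l, p, k)\<in>{..m} \<times> {..n} \<times> {..q}. ?A l p k) =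
      (\<Sum>(l, p, k)\<in>{..m} \<times> {..n} \<times> {..q}. G * ?B l p k)"
    by (intro sum.cong) auto
  also have "\<dots> = G * (\<Sum>l\<le>m. \<Sum>p\<le>n. \<Sum>k\<le>q. ?B l p k)"
    by (simp only: sum.cartesian_product' sum_distrib_left prod.case)
  also have "\<dots> = ml_coeff (\<delta>\<^sub>1 + \<delta>\<^sub>2) (\<eta>\<^sub>1 + \<eta>\<^sub>2) x y z (m, n, q)"
    by (simp only: pochhammer_trinomial_sum) (simp add: ml_coeff_def G_def)
  finally show ?thesis .
qed

text \<open>A Cauchy product over triples: pairs \<open>(i, j)\<close> are grouped by their sum, and
  each group is finite.\<close>

lemma infsum_ml_coeff_Beta:
  assumes \<delta>: "Re \<delta>\<^sub>1 > 0" "Re \<delta>\<^sub>2 > 0"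
    and hs: "((\<lambda>(i, j). ml_coeff \<delta>\<^sub>1 \<eta>\<^sub>1 x y z i * ml_coeff \<delta>\<^sub>2 \<eta>\<^sub>2 x y z j *
      (cut_powr (ml_exponent \<delta>\<^sub>1 i + ml_exponent \<delta>\<^sub>2 j) r *
       Beta (ml_exponent \<delta>\<^sub>1 i) (ml_exponent \<delta>\<^sub>2 j))) has_sum I) UNIV"
      (is "(?S has_sum I) UNIV")
  shows "I =
    (\<Sum>\<^sub>\<infinity>m. ml_coeff (\<delta>\<^sub>1 + \<delta>\<^sub>2) (\<eta>\<^sub>1 + \<eta>\<^sub>2) x y z m * cut_powr (ml_exponent (\<delta>\<^sub>1 + \<delta>\<^sub>2) m) r)"
proof -
  define D :: "nat \<times> nat \<times> nat \<Rightarrow> (nat \<times> nat \<times> nat) set"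
    where "D = (\<lambda>(m, n, q). {..m} \<times> {..n} \<times> {..q})"
  \<comment> \<open>\<open>\<phi>\<close> recovers a pair from its sum and its first component; on
    \<open>D\<close> the truncated subtractions are genuine.\<close>
  define \<phi> :: "(nat \<times> nat \<times> nat) \<times> nat \<times> nat \<times> nat \<Rightarrow> (nat \<times> nat \<times> nat) \<times> nat \<times> nat \<times> nat"
    where "\<phi> = (\<lambda>((m, n, q), (l, p, k)). ((l, p, k), (m - l, n - p, q - k)))"
  have bij: "bij_betw \<phi> (Sigma UNIV D) UNIV"
    by (rule bij_betwI[where g = "\<lambda>((l, p, k), (l', p', k')). ((l + l', p + p', k + k'), (l, p, k))"])
       (auto simp: \<phi>_def D_def)
  have sm: "(\<lambda>u. ?S (\<phi> u)) summable_on Sigma UNIV D"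
    using has_sum_imp_summable[OF hs] summable_on_reindex_bij_betw[OF bij, of ?S] by simp
  have inner: "(\<Sum>\<^sub>\<infinity>i\<in>D m. ?S (\<phi> (m, i))) =
      ml_coeff (\<delta>\<^sub>1 + \<delta>\<^sub>2) (\<eta>\<^sub>1 + \<eta>\<^sub>2) x y z m * cut_powr (ml_exponent (\<delta>\<^sub>1 + \<delta>\<^sub>2) m) r" for m
  proof (cases m)
    case (fields m1 m2 m3)
    have "(\<Sum>\<^sub>\<infinity>i\<in>D m. ?S (\<phi> (m, i))) = (\<Sum>i\<in>D m. ?S (\<phi> (m, i)))"
      by (rule infsum_finite) (simp add: D_def fields)
    also have "\<dots> = (\<Sum>(l, p, k)\<in>{..m1} \<times> {..m2} \<times> {..m3}.
        ml_coeff \<delta>\<^sub>1 \<eta>\<^sub>1 x y z (l, p, k) * ml_coeff \<delta>\<^sub>2 \<eta>\<^sub>2 x y z (m1 - l, m2 - p, m3 - k) *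
        Beta (ml_exponent \<delta>\<^sub>1 (l, p, k)) (ml_exponent \<delta>\<^sub>2 (m1 - l, m2 - p, m3 - k)) *
        cut_powr (ml_exponent (\<delta>\<^sub>1 + \<delta>\<^sub>2) m) r)"
      by (intro sum.cong) (auto simp: D_def \<phi>_def fields ml_exponent_add)
    also have "\<dots> = (\<Sum>(l, p, k)\<in>{..m1} \<times> {..m2} \<times> {..m3}.
        ml_coeff \<delta>\<^sub>1 \<eta>\<^sub>1 x y z (l, p, k) * ml_coeff \<delta>\<^sub>2 \<eta>\<^sub>2 x y z (m1 - l, m2 - p, m3 - k) *
        Beta (ml_exponent \<delta>\<^sub>1 (l, p, k)) (ml_exponent \<delta>\<^sub>2 (m1 - l, m2 - p, m3 - k))) *
        cut_powr (ml_exponent (\<delta>\<^sub>1 + \<delta>\<^sub>2) m) r"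
      by (simp add: sum_distrib_right case_prod_unfold)
    finally show ?thesis
      by (simp only: ml_coeff_Beta_sum[OF \<delta>] fields)
  qed
  have "I = infsum ?S UNIV"
    by (rule infsumI[OF hs, symmetric])
  also have "\<dots> = (\<Sum>\<^sub>\<infinity>u\<in>Sigma UNIV D. ?S (\<phi> u))"
    by (rule infsum_reindex_bij_betw[OF bij, symmetric])
  also have "\<dots> = (\<Sum>\<^sub>\<infinity>m. \<Sum>\<^sub>\<infinity>i\<in>D m. ?S (\<phi> (m, i)))"
    by (rule infsum_Sigma_banach[OF sm, symmetric])
  also have "\<dots> = (\<Sum>\<^sub>\<infinity>m. ml_coeff (\<delta>\<^sub>1 + \<delta>\<^sub>2) (\<eta>\<^sub>1 + \<eta>\<^sub>2) x y z m *
      cut_powr (ml_exponent (\<delta>\<^sub>1 + \<delta>\<^sub>2) m) r)"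
    by (rule infsum_cong) (rule inner)
  finally show ?thesis .
qed

lemma laplace_convolution_mittag_leffler3:
  assumes \<delta>: "Re \<delta>\<^sub>1 > 0" "Re \<delta>\<^sub>2 > 0" and r: "r > 0"
  shows "laplace_convolution
       (\<lambda>t. of_real t powr (\<delta>\<^sub>1 - 1) *
          mittag_leffler3 \<alpha> \<beta> \<gamma> \<delta>\<^sub>1 \<eta>\<^sub>1 (x * of_real t powr \<alpha>) (y * of_real t powr \<beta>) (z * of_real t powr \<gamma>))
       (\<lambda>t. of_real t powr (\<delta>\<^sub>2 - 1) *
          mittag_leffler3 \<alpha> \<beta> \<gamma> \<delta>\<^sub>2 \<eta>\<^sub>2 (x * of_real t powr \<alpha>) (y * of_real t powr \<beta>) (z * of_real t powr \<gamma>)) r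
     = of_real r powr (\<delta>\<^sub>1 + \<delta>\<^sub>2 - 1) *
         mittag_leffler3 \<alpha> \<beta> \<gamma> (\<delta>\<^sub>1 + \<delta>\<^sub>2) (\<eta>\<^sub>1 + \<eta>\<^sub>2)
           (x * of_real r powr \<alpha>) (y * of_real r powr \<beta>) (z * of_real r powr \<gamma>)"
    (is "laplace_convolution ?f ?g r = ?rhs")
proof -
  define c where "c = ml_coeff \<delta>\<^sub>1 \<eta>\<^sub>1 x y z"
  define d where "d = ml_coeff \<delta>\<^sub>2 \<eta>\<^sub>2 x y z"
  define a where "a = ml_exponent \<delta>\<^sub>1"
  define b where "b = ml_exponent \<delta>\<^sub>2"
  have a: "Re (a i) \<ge> Re \<delta>\<^sub>1" "Re (a i) > 0" and b: "Re (b i) \<ge> Re \<delta>\<^sub>2" "Re (b i) > 0" for i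
    using \<delta> by (auto simp: a_def b_def Re_ml_exponent_ge Re_ml_exponent_pos)
  have sc: "(\<lambda>i. norm (c i * cut_powr (a i) t)) summable_on UNIV"
    and sd: "(\<lambda>i. norm (d i * cut_powr (b i) t)) summable_on UNIV" for t
    using ml_term_abs_summable \<delta> by (simp_all only: c_def d_def a_def b_def)
  \<comment> \<open>The terms of the product of the two series at \<open>r - s\<close> and
    \<open>s\<close>, as functions on the whole line.\<close>
  define T where "T = (\<lambda>(i, j) s. c i * d j * (cut_powr (a i) (r - s) * cut_powr (b j) s))"
  have T_eq: "T q s = (case q of (i, j) \<Rightarrow> (c i * cut_powr (a i) (r - s)) * (d j * cut_powr (b j) s))" for q s
    by (simp add: T_def split: prod.split)
  have T_int: "has_bochner_integral lborel (T (i, j)) (c i * d j * (cut_powr (a i + b j) r * Beta (a i) (b j)))" for i j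
    unfolding T_def prod.case using a b
    by (intro has_bochner_integral_mult_right has_bochner_integral_cut_powr_conv)
  have T_norm: "(\<integral>s. norm (T (i, j) s) \<partial>lborel) =
      norm (c i) * norm (d j) * (r powr (Re (a i) + Re (b j) - 1) * Beta (Re (a i)) (Re (b j)))" for i j
    using has_bochner_integral_norm_cut_powr_conv[OF a(2) b(2) r, of i j]
    by (simp add: T_def norm_mult[of "_ * _"] norm_mult[of "c i"] has_bochner_integral_iff)
  have "((\<lambda>q. \<integral>s. T q s \<partial>lborel) has_sum (\<integral>s. (\<Sum>\<^sub>\<infinity>q. T q s) \<partial>lborel)) UNIV"
  proof (rule has_sum_integral_infsum)
    show "integrable lborel (T q)" for q
      using T_int by (cases q) (auto simp: has_bochner_integral_iff)
    show "(\<lambda>q. norm (T q s)) summable_on UNIV" for s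
      using abs_summable_on_times[OF sc sd] by (simp add: T_eq)
    show "(\<lambda>q. \<integral>s. norm (T q s) \<partial>lborel) summable_on UNIV"
    proof (rule summable_on_comparison_test)
      \<comment> \<open>Since Beta is decreasing, its value at \<open>Re \<delta>\<^sub>1\<close>
        and \<open>Re \<delta>\<^sub>2\<close> bounds all Beta factors. The power of
        \<open>r\<close> splits into \<open>r\<close> times the two powers in the terms at
        \<open>t = r\<close>, whose series converge absolutely.\<close>
      show "(\<lambda>q. r * Beta (Re \<delta>\<^sub>1) (Re \<delta>\<^sub>2) *
          norm (case q of (i, j) \<Rightarrow> (c i * cut_powr (a i) r) * (d j * cut_powr (b j) r))) summable_on UNIV"
        using abs_summable_on_times[OF sc sd] by (intro summable_on_cmult_right) simp
      show "(\<integral>s. norm (T q s) \<partial>lborel) \<le> r * Beta (Re \<delta>\<^sub>1) (Re \<delta>\<^sub>2) *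
          norm (case q of (i, j) \<Rightarrow> (c i * cut_powr (a i) r) * (d j * cut_powr (b j) r))" for q
      proof -
        obtain i j where q: "q = (i, j)"
          by (cases q)
        have "r powr (Re (a i) + Re (b j) - 1) = r * (r powr (Re (a i) - 1) * r powr (Re (b j) - 1))"
          using r powr_add[of r 1 "Re (a i) + Re (b j) - 2"] by (simp add: powr_add[symmetric] algebra_simps)
        moreover have "Beta (Re (a i)) (Re (b j)) \<le> Beta (Re \<delta>\<^sub>1) (Re \<delta>\<^sub>2)"
          using a b \<delta> by (intro Beta_real_mono)
        ultimately have "r powr (Re (a i) + Re (b j) - 1) * Beta (Re (a i)) (Re (b j)) \<le>
            r * (r powr (Re (a i) - 1) * r powr (Re (b j) - 1)) * Beta (Re \<delta>\<^sub>1) (Re \<delta>\<^sub>2)"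
          using r by (simp add: mult_left_mono)
        then have "norm (c i) * norm (d j) * (r powr (Re (a i) + Re (b j) - 1) * Beta (Re (a i)) (Re (b j))) \<le>
            norm (c i) * norm (d j) * (r * (r powr (Re (a i) - 1) * r powr (Re (b j) - 1)) * Beta (Re \<delta>\<^sub>1) (Re \<delta>\<^sub>2))"
          by (intro mult_left_mono) auto
        then show ?thesis
          using r by (simp add: q T_norm norm_mult norm_cut_powr mult_ac)
      qed
    qed auto
  qed
  moreover have "(\<integral>s. T q s \<partial>lborel) =
      (case q of (i, j) \<Rightarrow> c i * d j * (cut_powr (a i + b j) r * Beta (a i) (b j)))" for q
    using T_int by (cases q) (simp add: has_bochner_integral_iff)
  ultimately have hs: "((\<lambda>(i, j). c i * d j * (cut_powr (a i + b j) r * Beta (a i) (b j)))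
      has_sum (\<integral>s. (\<Sum>\<^sub>\<infinity>q. T q s) \<partial>lborel)) UNIV"
    by (simp only:)
  \<comment> \<open>Outside the open interval one of the two cut powers vanishes. The interval is
    open at both ends, as in the interval integral of \<open>laplace_convolution\<close>.\<close>
  have "(\<Sum>\<^sub>\<infinity>q. T q s) = indicator {0<..<r} s *\<^sub>R (?f (r - s) * ?g s)" for s
  proof (cases "s \<in> {0<..<r}")
    case True
    have "(\<Sum>\<^sub>\<infinity>q. T q s) = (\<Sum>\<^sub>\<infinity>i. c i * cut_powr (a i) (r - s)) * (\<Sum>\<^sub>\<infinity>j. d j * cut_powr (b j) s)"
      unfolding T_eq infsum_times[OF sc sd] by simp
    with True show ?thesis
      unfolding c_def d_def a_def b_def by (simp add: infsum_ml_term \<delta>)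
  next
    case False
    then have "T q s = 0" for q
      by (auto simp: T_def cut_powr_def split: prod.split)
    with False show ?thesis by simp
  qed
  then have "laplace_convolution ?f ?g r = (\<integral>s. (\<Sum>\<^sub>\<infinity>q. T q s) \<partial>lborel)"
    using r by (simp add: laplace_convolution_def interval_lebesgue_integral_def
        set_lebesgue_integral_def zero_ereal_def)
  also have "\<dots> = (\<Sum>\<^sub>\<infinity>m. ml_coeff (\<delta>\<^sub>1 + \<delta>\<^sub>2) (\<eta>\<^sub>1 + \<eta>\<^sub>2) x y z m * cut_powr (ml_exponent (\<delta>\<^sub>1 + \<delta>\<^sub>2) m) r)"
    using hs unfolding a_def b_def c_def d_def
    by (rule infsum_ml_coeff_Beta[OF \<delta>])
  also have "\<dots> = ?rhs"
    using \<delta> r by (intro infsum_ml_term) auto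
  finally show ?thesis .
qed

end

theorem theorem2p3:
  fixes lam\<^sub>1 lam\<^sub>2 lam\<^sub>3 \<alpha> \<beta> \<gamma> \<delta>\<^sub>1 \<delta>\<^sub>2 \<eta>\<^sub>1 \<eta>\<^sub>2 :: complex and r :: real
  assumes "Re \<alpha> > 0" and "Re \<beta> > 0" and "Re \<gamma> > 0"
    and "Re \<delta>\<^sub>1 > 0" and "Re \<delta>\<^sub>2 > 0"
    and "r > 0"
  shows
    "laplace_convolution
       (\<lambda>t. of_real t powr (\<delta>\<^sub>1 - 1) *
          mittag_leffler3 \<alpha> \<beta> \<gamma> \<delta>\<^sub>1 \<eta>\<^sub>1
            (lam\<^sub>1 * of_real t powr \<alpha>) (lam\<^sub>2 * of_real t powr \<beta>) (lam\<^sub>3 * of_real t powr \<gamma>))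
       (\<lambda>t. of_real t powr (\<delta>\<^sub>2 - 1) *
          mittag_leffler3 \<alpha> \<beta> \<gamma> \<delta>\<^sub>2 \<eta>\<^sub>2
            (lam\<^sub>1 * of_real t powr \<alpha>) (lam\<^sub>2 * of_real t powr \<beta>) (lam\<^sub>3 * of_real t powr \<gamma>))
       r
     = of_real r powr (\<delta>\<^sub>1 + \<delta>\<^sub>2 - 1) *
         mittag_leffler3 \<alpha> \<beta> \<gamma> (\<delta>\<^sub>1 + \<delta>\<^sub>2) (\<eta>\<^sub>1 + \<eta>\<^sub>2)
           (lam\<^sub>1 * of_real r powr \<alpha>) (lam\<^sub>2 * of_real r powr \<beta>) (lam\<^sub>3 * of_real r powr \<gamma>)"
proof -
  interpret mittag_leffler_exponents \<alpha> \<beta> \<gamma>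
    using assms by unfold_locales
  show ?thesis
    by (rule laplace_convolution_mittag_leffler3[OF assms(4-6)])
qed

end
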